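(* Let $\mathsf{NQ.L}$ be any properly closed nested calculus and let $\mathcal S$ be a nested sequent. If $\mathsf{NQ.L}\vdash\mathcal S$, then the formula $\mathtt{fm}(\mathcal S)$ is $\mathsf{Q.L}$-valid.
   Context: **Language.** Fix, for each $n$, an at most countable set of $n$-ary predicates $R^n_i$, and a denumerable set of variables. Formulas of $\mathcal L$: $A::=R_i^n(x_1,\dots,x_n)\mid x_1=x_2\mid\bot\mid A\supset A\mid\forall xA\mid\Box A$. Atomic formulas are those of shape $R_i^n(x_1,\dots,x_n)$ or $x_1=x_2$. Other connectives, $\exists$ and $\Diamond$ are defined as usual. $A(y/x)$ is capture-avoiding substitution (renaming bound variables if needed). **Semantics and axiom sets.** A frame is $\langle\mathcal W,\mathcal R,\mathcal D\rangle$ with $\mathcal W\neq\varnothing$, $\mathcal R\subseteq\mathcal W^2$, and $\mathcal D$ assigning to each $w\in\mathcal W$ a possibly empty set $\mathcal D_w$, with $\mathcal D_v\ne\varnothing$ for some $v$. Put $\mathcal D_{\mathcal W}=\bigcup_{v}\mathcal D_v$. A model is a frame with a valuation $\mathcal V$ such that $\mathcal V(w,R^n)\subseteq(\mathcal D_{\mathcal W})^n$. An assignment $\sigma$ maps variables to $\mathcal D_{\mathcal W}$; $\sigma^{x\triangleright o}$ is $\sigma$ modified to send $x$ to $o$. Satisfaction at $w$: $\sigma\Vdash_wR^n(x_1,\dots,x_n)$ iff $\langle\sigma(x_1),\dots,\sigma(x_n)\rangle\in\mathcal V(w,R^n)$; $\sigma\Vdash_wx=y$ iff $\sigma(x)=\sigma(y)$;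 $\sigma\not\Vdash_w\bot$; $\sigma\Vdash_wA\supset B$ iff $\sigma\not\Vdash_wA$ or $\sigma\Vdash_wB$; $\sigma\Vdash_w\forall xA$ iff $\sigma^{x\triangleright o}\Vdash_wA$ for every $o\in\mathcal D_w$; $\sigma\Vdash_w\Box A$ iff $\sigma\Vdash_vA$ for all $v$ with $w\mathcal Rv$. A formula is valid in a frame iff it is satisfied at all worlds of all models on the frame under all assignments. Axiom names correspond to frame properties: $\mathbf D$: $\mathcal R$ serial; $\mathbf T$: reflexive; $\mathbf B$: symmetric; $\mathbf 4$: transitive; $\mathbf 5$: Euclidean ($w\mathcal Rv$ and $w\mathcal Ru$ imply $v\mathcal Ru$); $\mathbf{CBF}$: $w\mathcal Rv$ implies $\mathcal D_w\subseteq\mathcal D_v$; $\mathbf{BF}$: $w\mathcal Rv$ implies $\mathcal D_w\supseteq\mathcal D_v$; $\mathbf{UI}$: $\mathcal D_w=\mathcal D_v$ for all $w,v$. For $\mathsf L\subseteq\{\mathbf D,\mathbf T,\mathbf B,\mathbf 4,\mathbf 5,\mathbf{CBF},\mathbf{BF},\mathbf{UI}\}$, a $\mathsf{Q.L}$-frame is a frame with the properties of all members of $\mathsf L$; a formula is $\mathsf{Q.L}$-valid iff it is valid in all $\mathsf{Q.L}$-frames. $\mathsf L$ is properly closed iff for every $Z\in\{\mathbf 4,\mathbf 5,\mathbf{CBF},\mathbf{BF}\}$, if all $\mathsf{Q.L}$-frames have the property of $Z$, then $Z\in\mathsf L$. **Nested sequents.** A sequent is $X;\Gamma\Rightarrow\Delta$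 with $X$ (the signature) a finite multiset of variables and $\Gamma,\Delta$ finite multisets of formulas (an omitted signature is empty). A nested sequent is $X;\Gamma\Rightarrow\Delta,[\mathcal S_1],\dots,[\mathcal S_n]$ with $\mathcal S_i$ nested sequents: a finite tree of sequents with root $X;\Gamma\Rightarrow\Delta$ and the $\mathcal S_i$ as immediate subtrees (order irrelevant). A context $\mathcal S\{\cdot\}\cdots\{\cdot\}$ is a nested sequent with finitely many holes, each located at some node, in arbitrary relative positions (several holes may be at one node). Plugging $Y;\Pi\Rightarrow\Sigma,[\mathcal S'_1],\dots,[\mathcal S_k']$ into a hole at a node adds $Y,\Pi,\Sigma$ to the signature, antecedent, succedent of that node (multiset union) and adds the $\mathcal S'_j$ as further children; plugging $\emptyset$ removes the hole. The depth of a hole is the distance of its node from the root. When a bracketed component $[Y;\Pi\Rightarrow\Sigma]$ is displayed in both premiss and conclusion of a rule, that node may have further children, which stay attached to it; components displayed as newly created are leaves. **Formula interpretation.** With $\mathcal Ex:=\exists y(y=x)$, empty conjunction $\top$ and empty disjunction $\bot$, $$\mathtt{fm}(X;\Gamma\Rightarrow\Delta,[\mathcal S_1],\dots,[\mathcal S_n])\equiv\Big(\bigwedge_{x\in X}\mathcal Ex\wedge\bigwedge\Gamma\supset\bigvee\Delta\Big)\lor\bigvee_{k=1}^n\Box\,\mathtt{fm}(\mathcal S_k).$$ **Rules** (premisses / conclusion). $\mathsf{NQ.K}$ consists of: - Initial sequents $\mathcal S\{X;P,\Gamma\Rightarrow\Delta,P\}$, $P$ atomic; and $L\bot$: $\mathcal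 S\{X;\bot,\Gamma\Rightarrow\Delta\}$ (no premisses). - $L{\supset}$: $\mathcal S\{X;\Gamma\Rightarrow\Delta,A\}$ and $\mathcal S\{X;B,\Gamma\Rightarrow\Delta\}$ / $\mathcal S\{X;A\supset B,\Gamma\Rightarrow\Delta\}$. $R{\supset}$: $\mathcal S\{X;A,\Gamma\Rightarrow\Delta,B\}$ / $\mathcal S\{X;\Gamma\Rightarrow\Delta,A\supset B\}$. - $L\forall$: $\mathcal S\{X,z;A(z/x),\forall xA,\Gamma\Rightarrow\Delta\}$ / $\mathcal S\{X,z;\forall xA,\Gamma\Rightarrow\Delta\}$. $R\forall$: $\mathcal S\{X,y;\Gamma\Rightarrow\Delta,A(y/x)\}$ / $\mathcal S\{X;\Gamma\Rightarrow\Delta,\forall xA\}$, $y$ (the eigenvariable) fresh, i.e. not occurring in the conclusion. - $L\Box$: $\mathcal S\{X;\Box A,\Gamma\Rightarrow\Delta,[Y;A,\Pi\Rightarrow\Sigma]\}$ / $\mathcal S\{X;\Box A,\Gamma\Rightarrow\Delta,[Y;\Pi\Rightarrow\Sigma]\}$. $R\Box$: $\mathcal S\{X;\Gamma\Rightarrow\Delta,[\emptyset;\Rightarrow A]\}$ / $\mathcal S\{X;\Gamma\Rightarrow\Delta,\Box A\}$. - $Ref$: $\mathcal S\{X;x=x,\Gamma\Rightarrow\Delta\}$ / $\mathcal S\{X;\Gamma\Rightarrow\Delta\}$. $Repl$ ($P$ atomic): $\mathcal S\{X;P(y/z),x=y,P(x/z),\Gamma\Rightarrow\Delta\}$ / $\mathcal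 S\{X;x=y,P(x/z),\Gamma\Rightarrow\Delta\}$. $Repl_X$: $\mathcal S\{X,x,y;x=y,\Gamma\Rightarrow\Delta\}$ / $\mathcal S\{X,x;x=y,\Gamma\Rightarrow\Delta\}$. $Rig$: $\mathcal S\{X;x=y,\Gamma\Rightarrow\Delta\}\{Y;x=y,\Pi\Rightarrow\Sigma\}$ / $\mathcal S\{X;x=y,\Gamma\Rightarrow\Delta\}\{Y;\Pi\Rightarrow\Sigma\}$. $\mathsf{NQ.L}$ adds the rule of each member of $\mathsf L$: - $R_D$ ($\mathbf D$): $\mathcal S\{X;\Gamma\Rightarrow\Delta,[\emptyset;\Rightarrow]\}$ / $\mathcal S\{X;\Gamma\Rightarrow\Delta\}$. $R_T$ ($\mathbf T$): $\mathcal S\{X;A,\Box A,\Gamma\Rightarrow\Delta\}$ / $\mathcal S\{X;\Box A,\Gamma\Rightarrow\Delta\}$. $R_B$ ($\mathbf B$): $\mathcal S\{X;A,\Gamma\Rightarrow\Delta,[Y;\Box A,\Pi\Rightarrow\Sigma]\}$ / $\mathcal S\{X;\Gamma\Rightarrow\Delta,[Y;\Box A,\Pi\Rightarrow\Sigma]\}$. $R_4$ ($\mathbf 4$): $\mathcal S\{X;\Box A,\Gamma\Rightarrow\Delta,[Y;\Box A,\Pi\Rightarrow\Sigma]\}$ / $\mathcal S\{X;\Box A,\Gamma\Rightarrow\Delta,[Y;\Pi\Rightarrow\Sigma]\}$. $R_5$ ($\mathbf 5$): $\mathcal S\{X;\Box A,\Gamma\Rightarrow\Delta\}\{Y;\Box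 A,\Pi\Rightarrow\Sigma\}$ / $\mathcal S\{X;\Box A,\Gamma\Rightarrow\Delta\}\{Y;\Pi\Rightarrow\Sigma\}$, first hole of depth $\ge1$. - $R_{cbf}$ ($\mathbf{CBF}$): $\mathcal S\{X,x;\Gamma\Rightarrow\Delta,[Y,x;\Pi\Rightarrow\Sigma]\}$ / $\mathcal S\{X,x;\Gamma\Rightarrow\Delta,[Y;\Pi\Rightarrow\Sigma]\}$. $R_{bf}$ ($\mathbf{BF}$): $\mathcal S\{X,x;\Gamma\Rightarrow\Delta,[Y,x;\Pi\Rightarrow\Sigma]\}$ / $\mathcal S\{X;\Gamma\Rightarrow\Delta,[Y,x;\Pi\Rightarrow\Sigma]\}$. $R_{ui}$ ($\mathbf{UI}$): $\mathcal S\{X,x;\Gamma\Rightarrow\Delta\}$ / $\mathcal S\{X;\Gamma\Rightarrow\Delta\}$. - $R_{5dom}$: $\mathcal S\{X,x;\Gamma\Rightarrow\Delta\}\{Y,x;\Pi\Rightarrow\Sigma\}$ / $\mathcal S\{X,x;\Gamma\Rightarrow\Delta\}\{Y;\Pi\Rightarrow\Sigma\}$, both holes of depth $\ge1$; it is a rule of $\mathsf{NQ.L}$ iff $\mathbf 5\in\mathsf L$ and $\{\mathbf{CBF},\mathbf{BF}\}\cap\mathsf L\ne\emptyset$. $\mathsf{NQ.L}$ is properly closed iff $\mathsf L$ is properly closed and $R_{5dom}$ is included exactly as just stated. **Derivations.** An $\mathsf{NQ.L}$-derivation of $\mathcal S$ is a finite tree of nested sequents with root $\mathcal S$, built by the rules,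 with leaves initial sequents (or instances of $L\bot$). Only derivations of pure sequents are considered: no variable occurs both free and bound, and eigenvariables are pairwise distinct. $\mathsf{NQ.L}\vdash\mathcal S$ iff $\mathcal S$ or an alphabetical variant (bound renaming) of it has a derivation. *)

theory Defs
  imports Main "HOL-Library.Multiset" "HOL-Library.Countable_Set"
begin

section \<open>Language\<close>

type_synonym var = nat

text \<open>\<open>Pred i [x\<^sub>1, \<dots>, x\<^sub>n]\<close> is \<open>R\<^sup>n\<^sub>i(x\<^sub>1, \<dots>, x\<^sub>n)\<close>: the arity of a predicate symbol is the
  length of its argument list. A language is a family \<open>I :: nat \<Rightarrow> nat set\<close>, where \<open>I n\<close> is the
  (at most countable, possibly empty) set of indices of its \<open>n\<close>-ary predicates.\<close>

datatype form =
    Pred nat "var list"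
  | Eq var var
  | Bot
  | Imp form form
  | All var form
  | Box form

primrec in_language :: "(nat \<Rightarrow> nat set) \<Rightarrow> form \<Rightarrow> bool" where
  "in_language I (Pred i xs) \<longleftrightarrow> i \<in> I (length xs)"
| "in_language I (Eq x y) \<longleftrightarrow> True"
| "in_language I Bot \<longleftrightarrow> True"
| "in_language I (Imp A B) \<longleftrightarrow> in_language I A \<and> in_language I B"
| "in_language I (All x A) \<longleftrightarrow> in_language I A"
| "in_language I (Box A) \<longleftrightarrow> in_language I A"

fun atomic :: "form \<Rightarrow> bool" where
  "atomic (Pred i xs) \<longleftrightarrow> True"
| "atomic (Eq x y) \<longleftrightarrow> True"
| "atomic _ \<longleftrightarrow> False"

definition Neg :: "form \<Rightarrow> form" where "Neg A = Imp A Bot"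
definition Top :: form where "Top = Neg Bot"
definition Or :: "form \<Rightarrow> form \<Rightarrow> form" where "Or A B = Imp (Neg A) B"
definition And :: "form \<Rightarrow> form \<Rightarrow> form" where "And A B = Neg (Imp A (Neg B))"
definition Exi :: "var \<Rightarrow> form \<Rightarrow> form" where "Exi x A = Neg (All x (Neg A))"

primrec fv :: "form \<Rightarrow> var set" where
  "fv (Pred i xs) = set xs"
| "fv (Eq x y) = {x, y}"
| "fv Bot = {}"
| "fv (Imp A B) = fv A \<union> fv B"
| "fv (All x A) = fv A - {x}"
| "fv (Box A) = fv A"

primrec bv :: "form \<Rightarrow> var set" where
  "bv (Pred i xs) = {}"
| "bv (Eq x y) = {}"
| "bv Bot = {}"
| "bv (Imp A B) = bv A \<union> bv B"
| "bv (All x A) = insert x (bv A)"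
| "bv (Box A) = bv A"

text \<open>Simultaneous capture-avoiding replacement of the free variables by a map \<open>r\<close>. A bound
  variable is renamed only if it would otherwise capture the image of a free variable.\<close>

primrec rename :: "(var \<Rightarrow> var) \<Rightarrow> form \<Rightarrow> form" where
  "rename r (Pred i xs) = Pred i (map r xs)"
| "rename r (Eq x y) = Eq (r x) (r y)"
| "rename r Bot = Bot"
| "rename r (Imp A B) = Imp (rename r A) (rename r B)"
| "rename r (All x A) =
     (let C = r ` (fv A - {x});
          z = (if x \<in> C then (LEAST z. z \<notin> C) else x)
      in All z (rename (r(x := z)) A))"
| "rename r (Box A) = Box (rename r A)"

text \<open>\<open>subst A y x\<close> is \<open>A(y/x)\<close>.\<close>

definition subst :: "form \<Rightarrow> var \<Rightarrow> var \<Rightarrow> form" where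
  "subst A y x = rename (id(x := y)) A"

inductive alpha :: "form \<Rightarrow> form \<Rightarrow> bool" where
  alpha_refl: "alpha A A"
| alpha_sym: "alpha A B \<Longrightarrow> alpha B A"
| alpha_trans: "alpha A B \<Longrightarrow> alpha B C \<Longrightarrow> alpha A C"
| alpha_Imp: "alpha A A' \<Longrightarrow> alpha B B' \<Longrightarrow> alpha (Imp A B) (Imp A' B')"
| alpha_All: "alpha A A' \<Longrightarrow> alpha (All x A) (All x A')"
| alpha_Box: "alpha A A' \<Longrightarrow> alpha (Box A) (Box A')"
| alpha_rename: "y \<notin> fv (All x A) \<Longrightarrow> alpha (All x A) (All y (subst A y x))"


section \<open>Semantics\<close>

record ('w, 'd) frame =
  worlds :: "'w set"
  acc :: "('w \<times> 'w) set"
  dom :: "'w \<Rightarrow> 'd set"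

definition is_frame :: "('w, 'd) frame \<Rightarrow> bool" where
  "is_frame F \<longleftrightarrow> worlds F \<noteq> {} \<and> acc F \<subseteq> worlds F \<times> worlds F \<and> (\<exists>v \<in> worlds F. dom F v \<noteq> {})"

definition all_objects :: "('w, 'd) frame \<Rightarrow> 'd set" where
  "all_objects F = (\<Union>v \<in> worlds F. dom F v)"

text \<open>\<open>V w n i\<close> is the extension of \<open>R\<^sup>n\<^sub>i\<close> at \<open>w\<close>; tuples are lists.\<close>

type_synonym ('w, 'd) valuation = "'w \<Rightarrow> nat \<Rightarrow> nat \<Rightarrow> 'd list set"

definition is_valuation :: "('w, 'd) frame \<Rightarrow> ('w, 'd) valuation \<Rightarrow> bool" where
  "is_valuation F V \<longleftrightarrow>
     (\<forall>w \<in> worlds F. \<forall>n i. V w n i \<subseteq> {os. length os = n \<and> set os \<subseteq> all_objects F})"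

primrec sat :: "('w, 'd) frame \<Rightarrow> ('w, 'd) valuation \<Rightarrow> (var \<Rightarrow> 'd) \<Rightarrow> 'w \<Rightarrow> form \<Rightarrow> bool" where
  "sat F V \<sigma> w (Pred i xs) \<longleftrightarrow> map \<sigma> xs \<in> V w (length xs) i"
| "sat F V \<sigma> w (Eq x y) \<longleftrightarrow> \<sigma> x = \<sigma> y"
| "sat F V \<sigma> w Bot \<longleftrightarrow> False"
| "sat F V \<sigma> w (Imp A B) \<longleftrightarrow> \<not> sat F V \<sigma> w A \<or> sat F V \<sigma> w B"
| "sat F V \<sigma> w (All x A) \<longleftrightarrow> (\<forall>a \<in> dom F w. sat F V (\<sigma>(x := a)) w A)"
| "sat F V \<sigma> w (Box A) \<longleftrightarrow> (\<forall>v. (w, v) \<in> acc F \<longrightarrow> sat F V \<sigma> v A)"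

definition valid_in :: "('w, 'd) frame \<Rightarrow> form \<Rightarrow> bool" where
  "valid_in F A \<longleftrightarrow>
     (\<forall>V \<sigma> w. is_valuation F V \<longrightarrow> (\<forall>x. \<sigma> x \<in> all_objects F) \<longrightarrow> w \<in> worlds F \<longrightarrow> sat F V \<sigma> w A)"

datatype axiom = AxD | AxT | AxB | Ax4 | Ax5 | AxCBF | AxBF | AxUI

primrec frame_prop :: "axiom \<Rightarrow> ('w, 'd) frame \<Rightarrow> bool" where
  "frame_prop AxD F \<longleftrightarrow> (\<forall>w \<in> worlds F. \<exists>v. (w, v) \<in> acc F)"
| "frame_prop AxT F \<longleftrightarrow> (\<forall>w \<in> worlds F. (w, w) \<in> acc F)"
| "frame_prop AxB F \<longleftrightarrow> sym (acc F)"
| "frame_prop Ax4 F \<longleftrightarrow> trans (acc F)"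
| "frame_prop Ax5 F \<longleftrightarrow> (\<forall>w v u. (w, v) \<in> acc F \<longrightarrow> (w, u) \<in> acc F \<longrightarrow> (v, u) \<in> acc F)"
| "frame_prop AxCBF F \<longleftrightarrow> (\<forall>w v. (w, v) \<in> acc F \<longrightarrow> dom F w \<subseteq> dom F v)"
| "frame_prop AxBF F \<longleftrightarrow> (\<forall>w v. (w, v) \<in> acc F \<longrightarrow> dom F v \<subseteq> dom F w)"
| "frame_prop AxUI F \<longleftrightarrow> (\<forall>w \<in> worlds F. \<forall>v \<in> worlds F. dom F w = dom F v)"

definition QL_frame :: "axiom set \<Rightarrow> ('w, 'd) frame \<Rightarrow> bool" where
  "QL_frame L F \<longleftrightarrow> is_frame F \<and> (\<forall>Z \<in> L. frame_prop Z F)"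

definition QL_valid :: "'w itself \<Rightarrow> 'd itself \<Rightarrow> axiom set \<Rightarrow> form \<Rightarrow> bool" where
  "QL_valid TYPE('w) TYPE('d) L A \<longleftrightarrow> (\<forall>F :: ('w, 'd) frame. QL_frame L F \<longrightarrow> valid_in F A)"

text \<open>``All \<open>Q.L\<close>-frames'' is a quantification over frames of arbitrary cardinality. Frames over
  \<open>nat\<close> suffice to express it: see \<open>properly_closed_all_types\<close> below.\<close>

definition properly_closed :: "axiom set \<Rightarrow> bool" where
  "properly_closed L \<longleftrightarrow>
     (\<forall>Z \<in> {Ax4, Ax5, AxCBF, AxBF}.
        (\<forall>F :: (nat, nat) frame. QL_frame L F \<longrightarrow> frame_prop Z F) \<longrightarrow> Z \<in> L)"

lemma countable_subframe:
  fixes F :: "('w, 'd) frame"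
  assumes F: "QL_frame L F" and A: "A \<subseteq> worlds F" "finite A" and a: "a \<in> A" "e \<in> dom F a"
  shows "\<exists>(f :: 'w \<Rightarrow> nat) (F' :: (nat, nat) frame). QL_frame L F' \<and>
    (\<forall>u \<in> A. \<forall>v \<in> A. (f u, f v) \<in> acc F' \<longleftrightarrow> (u, v) \<in> acc F) \<and>
    (\<forall>u \<in> A. dom F' (f u) = (if e \<in> dom F u then {0} else {}))"
proof -
  define s where "s w = (SOME v. (w, v) \<in> acc F)" for w
  define W where "W = (\<Union>n. (s ^^ n) ` A) \<inter> worlds F"
  define f where "f = to_nat_on W"
  define F' :: "(nat, nat) frame" where
    "F' = \<lparr>worlds = f ` W, acc = {(f u, f v) | u v. u \<in> W \<and> v \<in> W \<and> (u, v) \<in> acc F},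
           dom = (\<lambda>n. if e \<in> dom F (inv_into W f n) then {0} else {})\<rparr>"
  have "countable (\<Union>n. (s ^^ n) ` A)"
    using A(2) by (intro countable_UN) (auto intro: countable_finite)
  then have cW: "countable W" unfolding W_def by (metis countable_Int1)
  then have inj: "inj_on f W" unfolding f_def by (rule inj_on_to_nat_on)
  have AW: "A \<subseteq> W"
  proof
    fix x assume "x \<in> A"
    then have "x \<in> (s ^^ 0) ` A" by simp
    then show "x \<in> W" unfolding W_def using \<open>x \<in> A\<close> A(1) by blast
  qed
  have sub: "acc F \<subseteq> worlds F \<times> worlds F" and props: "\<And>Z. Z \<in> L \<Longrightarrow> frame_prop Z F"
    using F by (auto simp: QL_frame_def is_frame_def)
  have acc': "(f u, f v) \<in> acc F' \<longleftrightarrow> (u, v) \<in> acc F" if "u \<in> W" "v \<in> W" for u v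
    using that inj by (auto simp: F'_def dest: inj_onD)
  have acc_cases: "\<exists>u v. x = f u \<and> y = f v \<and> u \<in> W \<and> v \<in> W \<and> (u, v) \<in> acc F"
    if "(x, y) \<in> acc F'" for x y
    using that by (auto simp: F'_def)
  have dom': "dom F' (f u) = (if e \<in> dom F u then {0} else {})" if "u \<in> W" for u
    using that inj by (simp add: F'_def)
  have worlds': "worlds F' = f ` W" by (simp add: F'_def)
  have WF: "W \<subseteq> worlds F" by (auto simp: W_def)
  have "is_frame F'"
    unfolding is_frame_def using a AW dom' by (auto simp: F'_def)
  moreover have "frame_prop Z F'" if Z: "Z \<in> L" for Z
  proof (cases Z)
    case AxD
    have "\<exists>v. (f w, v) \<in> acc F'" if w: "w \<in> W" for w
    proof -
      have "\<exists>v. (w, v) \<in> acc F" using props[OF Z] AxD w WF by auto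
      then have ws: "(w, s w) \<in> acc F" unfolding s_def by (rule someI_ex)
      obtain n x where "x \<in> A" "w = (s ^^ n) x" using w by (auto simp: W_def)
      then have "s w \<in> (s ^^ Suc n) ` A" by auto
      then have "s w \<in> (\<Union>n. (s ^^ n) ` A)" by blast
      then have "s w \<in> W" using ws sub by (auto simp: W_def)
      then show ?thesis using acc'[OF w] ws by blast
    qed
    then show ?thesis using AxD by (auto simp: worlds')
  next
    case AxT
    then show ?thesis using props[OF Z] WF acc' by (auto simp: worlds')
  next
    case AxB
    then have S: "(u, v) \<in> acc F \<Longrightarrow> (v, u) \<in> acc F" for u v using props[OF Z] by (simp add: sym_def)
    show ?thesis unfolding AxB frame_prop.simps
    proof (rule symI)
      fix x y assume "(x, y) \<in> acc F'"
      then obtain u v where "x = f u" "y = f v" "u \<in> W" "v \<in> W" "(u, v) \<in> acc F"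
        using acc_cases by blast
      then show "(y, x) \<in> acc F'" using acc' S by simp
    qed
  next
    case Ax4
    then have S: "(u, v) \<in> acc F \<Longrightarrow> (v, w) \<in> acc F \<Longrightarrow> (u, w) \<in> acc F" for u v w
      using props[OF Z] transD[of "acc F" u v w] by simp
    show ?thesis unfolding Ax4 frame_prop.simps
    proof (rule transI)
      fix x y z assume "(x, y) \<in> acc F'" and yz: "(y, z) \<in> acc F'"
      then obtain u v where uv: "x = f u" "y = f v" "u \<in> W" "v \<in> W" "(u, v) \<in> acc F"
        using acc_cases by blast
      obtain v' w where w: "y = f v'" "z = f w" "v' \<in> W" "w \<in> W" "(v', w) \<in> acc F"
        using acc_cases[OF yz] by blast
      have "v = v'" using uv w inj by (auto dest: inj_onD)
      then show "(x, z) \<in> acc F'" using acc'[of u w] S[of u v w] uv w by simp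
    qed
  next
    case Ax5
    then have S: "(u, v) \<in> acc F \<Longrightarrow> (u, w) \<in> acc F \<Longrightarrow> (v, w) \<in> acc F" for u v w
      using props[OF Z] unfolding Ax5 frame_prop.simps by blast
    show ?thesis unfolding Ax5 frame_prop.simps
    proof (intro allI impI)
      fix x y z assume "(x, y) \<in> acc F'" and xz: "(x, z) \<in> acc F'"
      then obtain u v where uv: "x = f u" "y = f v" "u \<in> W" "v \<in> W" "(u, v) \<in> acc F"
        using acc_cases by blast
      obtain u' w where w: "x = f u'" "z = f w" "u' \<in> W" "w \<in> W" "(u', w) \<in> acc F"
        using acc_cases[OF xz] by blast
      have "u = u'" using uv w inj by (auto dest: inj_onD)
      then show "(y, z) \<in> acc F'" using acc'[of v w] S[of u v w] uv w by simp
    qed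
  next
    case AxCBF
    then have S: "(u, v) \<in> acc F \<Longrightarrow> dom F u \<subseteq> dom F v" for u v
      using props[OF Z] by auto
    show ?thesis unfolding AxCBF frame_prop.simps
    proof (intro allI impI)
      fix x y assume "(x, y) \<in> acc F'"
      then obtain u v where "x = f u" "y = f v" "u \<in> W" "v \<in> W" "(u, v) \<in> acc F"
        using acc_cases by blast
      then show "dom F' x \<subseteq> dom F' y" using dom' S[of u v] by auto
    qed
  next
    case AxBF
    then have S: "(u, v) \<in> acc F \<Longrightarrow> dom F v \<subseteq> dom F u" for u v
      using props[OF Z] by auto
    show ?thesis unfolding AxBF frame_prop.simps
    proof (intro allI impI)
      fix x y assume "(x, y) \<in> acc F'"
      then obtain u v where "x = f u" "y = f v" "u \<in> W" "v \<in> W" "(u, v) \<in> acc F"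
        using acc_cases by blast
      then show "dom F' y \<subseteq> dom F' x" using dom' S[of u v] by auto
    qed
  next
    case AxUI
    then show ?thesis using props[OF Z] WF dom' by (auto simp: worlds' subset_iff)
  qed
  ultimately have "QL_frame L F'" by (auto simp: QL_frame_def)
  then show ?thesis using acc' dom' AW by (metis subsetD)
qed

lemma properly_closed_all_types:
  assumes Z: "Z \<in> {Ax4, Ax5, AxCBF, AxBF}"
    and nat: "\<And>F :: (nat, nat) frame. QL_frame L F \<Longrightarrow> frame_prop Z F"
    and F: "QL_frame L (F :: ('w, 'd) frame)"
  shows "frame_prop Z F"
proof (rule ccontr)
  assume neg: "\<not> frame_prop Z F"
  have sub: "acc F \<subseteq> worlds F \<times> worlds F" using F by (auto simp: QL_frame_def is_frame_def)
  obtain a0 e0 where a0: "a0 \<in> worlds F" "e0 \<in> dom F a0"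
    using F by (auto simp: QL_frame_def is_frame_def)
  consider (4) u v w where "Z = Ax4" "(u, v) \<in> acc F" "(v, w) \<in> acc F" "(u, w) \<notin> acc F"
    | (5) u v w where "Z = Ax5" "(u, v) \<in> acc F" "(u, w) \<in> acc F" "(v, w) \<notin> acc F"
    | (C) u v e where "Z = AxCBF" "(u, v) \<in> acc F" "e \<in> dom F u" "e \<notin> dom F v"
    | (B) u v e where "Z = AxBF" "(u, v) \<in> acc F" "e \<in> dom F v" "e \<notin> dom F u"
  proof -
    from Z consider "Z = Ax4" | "Z = Ax5" | "Z = AxCBF" | "Z = AxBF" by blast
    then show thesis
    proof cases
      assume "Z = Ax4"
      moreover from this neg have "\<not> trans (acc F)" by simp
      then obtain u v w where "(u, v) \<in> acc F" "(v, w) \<in> acc F" "(u, w) \<notin> acc F"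
        unfolding trans_def by blast
      ultimately show thesis by (rule that(1))
    next
      assume "Z = Ax5"
      moreover from this neg obtain w v u
        where "(w, v) \<in> acc F" "(w, u) \<in> acc F" "(v, u) \<notin> acc F"
        by (metis frame_prop.simps(5))
      ultimately show thesis by (rule that(2))
    next
      assume "Z = AxCBF"
      moreover from this neg obtain u v e where "(u, v) \<in> acc F" "e \<in> dom F u" "e \<notin> dom F v"
        by auto
      ultimately show thesis by (rule that(3))
    next
      assume "Z = AxBF"
      moreover from this neg obtain u v e where "(u, v) \<in> acc F" "e \<in> dom F v" "e \<notin> dom F u"
        by auto
      ultimately show thesis by (rule that(4))
    qed
  qed
  then show False
  proof cases
    case 4
    then have A: "{u, v, w, a0} \<subseteq> worlds F" "finite {u, v, w, a0}" "a0 \<in> {u, v, w, a0}"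
      using sub a0 by auto
    obtain f :: "'w \<Rightarrow> nat" and F' :: "(nat, nat) frame" where *: "QL_frame L F'"
      "\<forall>x \<in> {u, v, w, a0}. \<forall>y \<in> {u, v, w, a0}. (f x, f y) \<in> acc F' \<longleftrightarrow> (x, y) \<in> acc F"
      using countable_subframe[OF F A a0(2)] by blast
    have "trans (acc F')" using nat[OF *(1)] 4 by simp
    then show False using *(2) 4 transD[of "acc F'" "f u" "f v" "f w"] by simp
  next
    case 5
    then have A: "{u, v, w, a0} \<subseteq> worlds F" "finite {u, v, w, a0}" "a0 \<in> {u, v, w, a0}"
      using sub a0 by auto
    obtain f :: "'w \<Rightarrow> nat" and F' :: "(nat, nat) frame" where *: "QL_frame L F'"
      "\<forall>x \<in> {u, v, w, a0}. \<forall>y \<in> {u, v, w, a0}. (f x, f y) \<in> acc F' \<longleftrightarrow> (x, y) \<in> acc F"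
      using countable_subframe[OF F A a0(2)] by blast
    have "\<forall>w v u. (w, v) \<in> acc F' \<longrightarrow> (w, u) \<in> acc F' \<longrightarrow> (v, u) \<in> acc F'"
      using nat[OF *(1)] unfolding 5(1) frame_prop.simps .
    moreover have "(f u, f v) \<in> acc F'" "(f u, f w) \<in> acc F'" "(f v, f w) \<notin> acc F'"
      using *(2) 5(2-4) by simp_all
    ultimately show False by blast
  next
    case C
    then have A: "{u, v} \<subseteq> worlds F" "finite {u, v}" "u \<in> {u, v}" using sub by auto
    obtain f :: "'w \<Rightarrow> nat" and F' :: "(nat, nat) frame" where *: "QL_frame L F'"
      "\<forall>x \<in> {u, v}. \<forall>y \<in> {u, v}. (f x, f y) \<in> acc F' \<longleftrightarrow> (x, y) \<in> acc F"
      "\<forall>x \<in> {u, v}. dom F' (f x) = (if e \<in> dom F x then {0} else {})"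
      using countable_subframe[OF F A C(3)] by blast
    have "dom F' (f u) \<subseteq> dom F' (f v)" using nat[OF *(1)] *(2) C by simp
    then show False using *(3) C by simp
  next
    case B
    then have A: "{u, v} \<subseteq> worlds F" "finite {u, v}" "v \<in> {u, v}" using sub by auto
    obtain f :: "'w \<Rightarrow> nat" and F' :: "(nat, nat) frame" where *: "QL_frame L F'"
      "\<forall>x \<in> {u, v}. \<forall>y \<in> {u, v}. (f x, f y) \<in> acc F' \<longleftrightarrow> (x, y) \<in> acc F"
      "\<forall>x \<in> {u, v}. dom F' (f x) = (if e \<in> dom F x then {0} else {})"
      using countable_subframe[OF F A B(3)] by blast
    have "dom F' (f v) \<subseteq> dom F' (f u)" using nat[OF *(1)] *(2) B by simp
    then show False using *(3) B by simp
  qed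
qed


section \<open>Nested sequents\<close>

text \<open>\<open>NS X \<Gamma> \<Delta> \<S>\<close> is \<open>X; \<Gamma> \<Rightarrow> \<Delta>, [S\<^sub>1], \<dots>, [S\<^sub>n]\<close>.\<close>

datatype nseq = NS (signat: "var multiset") (ante: "form multiset") (succd: "form multiset")
  (children: "nseq multiset")

primrec nforms :: "nseq \<Rightarrow> form set" where
  "nforms (NS X \<Gamma> \<Delta> Ss) = set_mset \<Gamma> \<union> set_mset \<Delta> \<union> \<Union> (set_mset (image_mset nforms Ss))"

primrec nsignat :: "nseq \<Rightarrow> var set" where
  "nsignat (NS X \<Gamma> \<Delta> Ss) = set_mset X \<union> \<Union> (set_mset (image_mset nsignat Ss))"

text \<open>Signature occurrences count as free.\<close>

definition nfv :: "nseq \<Rightarrow> var set" where "nfv S = nsignat S \<union> \<Union> (fv ` nforms S)"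
definition nbv :: "nseq \<Rightarrow> var set" where "nbv S = \<Union> (bv ` nforms S)"

definition pure :: "nseq \<Rightarrow> bool" where "pure S \<longleftrightarrow> nfv S \<inter> nbv S = {}"

definition nseq_in_language :: "(nat \<Rightarrow> nat set) \<Rightarrow> nseq \<Rightarrow> bool" where
  "nseq_in_language I S \<longleftrightarrow> (\<forall>A \<in> nforms S. in_language I A)"

inductive alpha_nseq :: "nseq \<Rightarrow> nseq \<Rightarrow> bool" where
  "rel_mset alpha \<Gamma> \<Gamma>' \<Longrightarrow> rel_mset alpha \<Delta> \<Delta>' \<Longrightarrow> rel_mset alpha_nseq Ss Ss' \<Longrightarrow>
   alpha_nseq (NS X \<Gamma> \<Delta> Ss) (NS X \<Gamma>' \<Delta>' Ss')"
monos multiset.rel_mono_strong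

text \<open>The order in which a finite multiset of formulas is listed is chosen arbitrarily.\<close>

definition listing :: "'a multiset \<Rightarrow> 'a list" where "listing M = (SOME xs. mset xs = M)"

fun conj_list :: "form list \<Rightarrow> form" where
  "conj_list [] = Top"
| "conj_list [A] = A"
| "conj_list (A # B # As) = And A (conj_list (B # As))"

fun disj_list :: "form list \<Rightarrow> form" where
  "disj_list [] = Bot"
| "disj_list [A] = A"
| "disj_list (A # B # As) = Or A (disj_list (B # As))"

definition BigAnd :: "form multiset \<Rightarrow> form" where "BigAnd M = conj_list (listing M)"
definition BigOr :: "form multiset \<Rightarrow> form" where "BigOr M = disj_list (listing M)"

text \<open>\<open>Suc x\<close> serves as the bound variable \<open>y \<noteq> x\<close> of \<open>\<exists>y (y = x)\<close>.\<close>

definition Exists_pred :: "var \<Rightarrow> form" where "Exists_pred x = Exi (Suc x) (Eq (Suc x) x)"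

primrec fm :: "nseq \<Rightarrow> form" where
  "fm (NS X \<Gamma> \<Delta> Ss) =
     Or (Imp (And (BigAnd (image_mset Exists_pred X)) (BigAnd \<Gamma>)) (BigOr \<Delta>))
        (BigOr (image_mset Box (image_mset fm Ss)))"


section \<open>Contexts\<close>

text \<open>\<open>Ctx X \<Gamma> \<Delta> H Cs\<close> is a node that carries one hole for each element of \<open>H\<close>; the elements of
  \<open>H\<close> are hole numbers. A context with \<open>n\<close> holes contains each of the numbers \<open>0, \<dots>, n - 1\<close>
  exactly once, at any nodes. \<open>plug C [T\<^sub>0, \<dots>, T\<^sub>n\<^sub>-\<^sub>1]\<close> fills hole \<open>i\<close> with \<open>T\<^sub>i\<close>; since the content
  is merged into the node of the hole, children from the context stay attached there.\<close>

datatype ctx = Ctx "var multiset" "form multiset" "form multiset" "nat multiset" "ctx multiset"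

primrec holes :: "ctx \<Rightarrow> nat multiset" where
  "holes (Ctx X \<Gamma> \<Delta> H Cs) = H + \<Sum>\<^sub># (image_mset holes Cs)"

definition n_holes :: "nat \<Rightarrow> ctx \<Rightarrow> bool" where "n_holes n C \<longleftrightarrow> holes C = mset [0..<n]"

primrec plug :: "ctx \<Rightarrow> nseq list \<Rightarrow> nseq" where
  "plug (Ctx X \<Gamma> \<Delta> H Cs) Ts =
     NS (X + (\<Sum>i\<in>#H. signat (Ts ! i))) (\<Gamma> + (\<Sum>i\<in>#H. ante (Ts ! i)))
        (\<Delta> + (\<Sum>i\<in>#H. succd (Ts ! i)))
        (image_mset (\<lambda>C. plug C Ts) Cs + (\<Sum>i\<in>#H. children (Ts ! i)))"

inductive hole_depth :: "ctx \<Rightarrow> nat \<Rightarrow> nat \<Rightarrow> bool" where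
  "i \<in># H \<Longrightarrow> hole_depth (Ctx X \<Gamma> \<Delta> H Cs) i 0"
| "C \<in># Cs \<Longrightarrow> hole_depth C i d \<Longrightarrow> hole_depth (Ctx X \<Gamma> \<Delta> H Cs) i (Suc d)"


section \<open>Nested calculi\<close>

text \<open>\<open>rule L Ps S y\<close>: there is an instance of a rule of \<open>NQ.L\<close> with premisses \<open>Ps\<close>, conclusion
  \<open>S\<close>, and eigenvariable \<open>y\<close> (if the rule has one).\<close>

inductive rule :: "axiom set \<Rightarrow> nseq list \<Rightarrow> nseq \<Rightarrow> var option \<Rightarrow> bool" for L where
  Init: "n_holes 1 C \<Longrightarrow> atomic P \<Longrightarrow>
    rule L [] (plug C [NS X (add_mset P \<Gamma>) (add_mset P \<Delta>) {#}]) None"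
| LBot: "n_holes 1 C \<Longrightarrow>
    rule L [] (plug C [NS X (add_mset Bot \<Gamma>) \<Delta> {#}]) None"
| LImp: "n_holes 1 C \<Longrightarrow>
    rule L
      [plug C [NS X \<Gamma> (add_mset A \<Delta>) {#}], plug C [NS X (add_mset B \<Gamma>) \<Delta> {#}]]
      (plug C [NS X (add_mset (Imp A B) \<Gamma>) \<Delta> {#}]) None"
| RImp: "n_holes 1 C \<Longrightarrow>
    rule L
      [plug C [NS X (add_mset A \<Gamma>) (add_mset B \<Delta>) {#}]]
      (plug C [NS X \<Gamma> (add_mset (Imp A B) \<Delta>) {#}]) None"
| LAll: "n_holes 1 C \<Longrightarrow>
    rule L
      [plug C [NS (add_mset z X) (add_mset (subst A z x) (add_mset (All x A) \<Gamma>)) \<Delta> {#}]]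
      (plug C [NS (add_mset z X) (add_mset (All x A) \<Gamma>) \<Delta> {#}]) None"
| RAll: "n_holes 1 C \<Longrightarrow> S = plug C [NS X \<Gamma> (add_mset (All x A) \<Delta>) {#}] \<Longrightarrow>
    y \<notin> nfv S \<union> nbv S \<Longrightarrow>
    rule L
      [plug C [NS (add_mset y X) \<Gamma> (add_mset (subst A y x) \<Delta>) {#}]]
      S (Some y)"
| LBox: "n_holes 1 C \<Longrightarrow>
    rule L
      [plug C [NS X (add_mset (Box A) \<Gamma>) \<Delta> {#NS Y (add_mset A \<Pi>) \<Sigma> Ss#}]]
      (plug C [NS X (add_mset (Box A) \<Gamma>) \<Delta> {#NS Y \<Pi> \<Sigma> Ss#}]) None"
| RBox: "n_holes 1 C \<Longrightarrow>
    rule L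
      [plug C [NS X \<Gamma> \<Delta> {#NS {#} {#} {#A#} {#}#}]]
      (plug C [NS X \<Gamma> (add_mset (Box A) \<Delta>) {#}]) None"
| Ref: "n_holes 1 C \<Longrightarrow>
    rule L
      [plug C [NS X (add_mset (Eq x x) \<Gamma>) \<Delta> {#}]]
      (plug C [NS X \<Gamma> \<Delta> {#}]) None"
| Repl: "n_holes 1 C \<Longrightarrow> atomic P \<Longrightarrow>
    rule L
      [plug C [NS X (add_mset (subst P y z) (add_mset (Eq x y) (add_mset (subst P x z) \<Gamma>))) \<Delta> {#}]]
      (plug C [NS X (add_mset (Eq x y) (add_mset (subst P x z) \<Gamma>)) \<Delta> {#}]) None"
| ReplX: "n_holes 1 C \<Longrightarrow>
    rule L
      [plug C [NS (add_mset x (add_mset y X)) (add_mset (Eq x y) \<Gamma>) \<Delta> {#}]]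
      (plug C [NS (add_mset x X) (add_mset (Eq x y) \<Gamma>) \<Delta> {#}]) None"
| Rig: "n_holes 2 C \<Longrightarrow>
    rule L
      [plug C [NS X (add_mset (Eq x y) \<Gamma>) \<Delta> {#}, NS Y (add_mset (Eq x y) \<Pi>) \<Sigma> {#}]]
      (plug C [NS X (add_mset (Eq x y) \<Gamma>) \<Delta> {#}, NS Y \<Pi> \<Sigma> {#}]) None"
| R_D: "AxD \<in> L \<Longrightarrow> n_holes 1 C \<Longrightarrow>
    rule L
      [plug C [NS X \<Gamma> \<Delta> {#NS {#} {#} {#} {#}#}]]
      (plug C [NS X \<Gamma> \<Delta> {#}]) None"
| R_T: "AxT \<in> L \<Longrightarrow> n_holes 1 C \<Longrightarrow>
    rule L
      [plug C [NS X (add_mset A (add_mset (Box A) \<Gamma>)) \<Delta> {#}]]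
      (plug C [NS X (add_mset (Box A) \<Gamma>) \<Delta> {#}]) None"
| R_B: "AxB \<in> L \<Longrightarrow> n_holes 1 C \<Longrightarrow>
    rule L
      [plug C [NS X (add_mset A \<Gamma>) \<Delta> {#NS Y (add_mset (Box A) \<Pi>) \<Sigma> Ss#}]]
      (plug C [NS X \<Gamma> \<Delta> {#NS Y (add_mset (Box A) \<Pi>) \<Sigma> Ss#}]) None"
| R_4: "Ax4 \<in> L \<Longrightarrow> n_holes 1 C \<Longrightarrow>
    rule L
      [plug C [NS X (add_mset (Box A) \<Gamma>) \<Delta> {#NS Y (add_mset (Box A) \<Pi>) \<Sigma> Ss#}]]
      (plug C [NS X (add_mset (Box A) \<Gamma>) \<Delta> {#NS Y \<Pi> \<Sigma> Ss#}]) None"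
| R_5: "Ax5 \<in> L \<Longrightarrow> n_holes 2 C \<Longrightarrow> hole_depth C 0 d \<Longrightarrow> 1 \<le> d \<Longrightarrow>
    rule L
      [plug C [NS X (add_mset (Box A) \<Gamma>) \<Delta> {#}, NS Y (add_mset (Box A) \<Pi>) \<Sigma> {#}]]
      (plug C [NS X (add_mset (Box A) \<Gamma>) \<Delta> {#}, NS Y \<Pi> \<Sigma> {#}]) None"
| R_cbf: "AxCBF \<in> L \<Longrightarrow> n_holes 1 C \<Longrightarrow>
    rule L
      [plug C [NS (add_mset x X) \<Gamma> \<Delta> {#NS (add_mset x Y) \<Pi> \<Sigma> Ss#}]]
      (plug C [NS (add_mset x X) \<Gamma> \<Delta> {#NS Y \<Pi> \<Sigma> Ss#}]) None"
| R_bf: "AxBF \<in> L \<Longrightarrow> n_holes 1 C \<Longrightarrow>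
    rule L
      [plug C [NS (add_mset x X) \<Gamma> \<Delta> {#NS (add_mset x Y) \<Pi> \<Sigma> Ss#}]]
      (plug C [NS X \<Gamma> \<Delta> {#NS (add_mset x Y) \<Pi> \<Sigma> Ss#}]) None"
| R_ui: "AxUI \<in> L \<Longrightarrow> n_holes 1 C \<Longrightarrow>
    rule L
      [plug C [NS (add_mset x X) \<Gamma> \<Delta> {#}]]
      (plug C [NS X \<Gamma> \<Delta> {#}]) None"
| R_5dom: "Ax5 \<in> L \<Longrightarrow> {AxCBF, AxBF} \<inter> L \<noteq> {} \<Longrightarrow> n_holes 2 C \<Longrightarrow>
    hole_depth C 0 d \<Longrightarrow> 1 \<le> d \<Longrightarrow> hole_depth C 1 d' \<Longrightarrow> 1 \<le> d' \<Longrightarrow>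
    rule L
      [plug C [NS (add_mset x X) \<Gamma> \<Delta> {#}, NS (add_mset x Y) \<Pi> \<Sigma> {#}]]
      (plug C [NS (add_mset x X) \<Gamma> \<Delta> {#}, NS Y \<Pi> \<Sigma> {#}]) None"

text \<open>Each inference records its eigenvariable, if any.\<close>

datatype deriv = Infer (endseq: nseq) "var option" "deriv list"

primrec is_derivation :: "axiom set \<Rightarrow> deriv \<Rightarrow> bool" where
  "is_derivation L (Infer S y ds) \<longleftrightarrow>
     rule L (map endseq ds) S y \<and> list_all (is_derivation L) ds"

primrec eigenvars :: "deriv \<Rightarrow> var list" where
  "eigenvars (Infer S y ds) = (case y of None \<Rightarrow> [] | Some z \<Rightarrow> [z]) @ concat (map eigenvars ds)"

definition has_derivation :: "axiom set \<Rightarrow> nseq \<Rightarrow> bool" where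
  "has_derivation L S \<longleftrightarrow>
     pure S \<and> (\<exists>d. is_derivation L d \<and> endseq d = S \<and> distinct (eigenvars d))"

lemma alpha_nseq_refl: "alpha_nseq S S"
proof (induction S)
  case (NS X \<Gamma> \<Delta> Ss)
  then show ?case
    by (auto intro!: alpha_nseq.intros multiset.rel_refl_strong alpha_refl)
qed

definition derivable :: "axiom set \<Rightarrow> nseq \<Rightarrow> bool" where
  "derivable L S \<longleftrightarrow> (\<exists>S'. alpha_nseq S S' \<and> has_derivation L S')"

end

theory Submission
  imports Defs
begin

text \<open>
  A countermodel of a nested sequent maps its tree into the frame, with a single assignment
  refuting the sequent at each node. A countermodel of the conclusion of a rule yields one of a
  premiss on the same frame: only at \<open>R\<forall>\<close> does the assignment change, at the fresh eigenvariable,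
  and only at \<open>R\<box>\<close> and \<open>R\<^sub>D\<close> does the tree grow. For \<open>R\<^sub>5\<close> and \<open>R\<^sub>5\<^sub>d\<^sub>o\<^sub>m\<close> one uses that, in a Euclidean
  frame, all worlds reachable from the root in at least one step see each other.
\<close>

section \<open>Substitution and bound renaming\<close>

lemma finite_fv: "finite (fv A)"
  by (induction A) auto

lemma sat_cong:
  "(\<And>x. x \<in> fv A \<Longrightarrow> \<sigma> x = \<tau> x) \<Longrightarrow> sat F V \<sigma> w A \<longleftrightarrow> sat F V \<tau> w A"
proof (induction A arbitrary: \<sigma> \<tau> w)
  case (Pred i xs)
  then have "map \<sigma> xs = map \<tau> xs" by simp
  then show ?case by (simp only: sat.simps)
next
  case (Imp A B)
  then show ?case by (metis UnCI fv.simps(4) sat.simps(4))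
next
  case (All x A)
  have "sat F V (\<sigma>(x := a)) w A \<longleftrightarrow> sat F V (\<tau>(x := a)) w A" for a
    by (rule All.IH) (use All.prems in auto)
  then show ?case by simp
next
  case (Box A)
  then show ?case by (metis fv.simps(6) sat.simps(6))
qed auto

text \<open>An arbitrary \<open>r\<close> is needed because each quantifier updates it. The bound
  variable chosen avoids the images of the free variables, so assigning to it cannot disturb their
  values.\<close>

lemma sat_rename: "sat F V \<sigma> w (rename r A) \<longleftrightarrow> sat F V (\<sigma> \<circ> r) w A"
proof (induction A arbitrary: \<sigma> r w)
  case (All x A)
  define C where "C = r ` (fv A - {x})"
  define z where "z = (if x \<in> C then (LEAST z. z \<notin> C) else x)"
  have "finite C" unfolding C_def by (simp add: finite_fv)
  \<comment> \<open>Only finitely many names are forbidden, so the \<open>LEAST\<close> in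
    \<open>rename\<close> does pick an admissible one.\<close>
  then have "\<exists>z. z \<notin> C" by (metis ex_new_if_finite infinite_UNIV_nat)
  then have z: "z \<notin> C" unfolding z_def
    by (metis (mono_tags, lifting) LeastI_ex)
  have "sat F V (\<sigma>(z := a) \<circ> r(x := z)) w A \<longleftrightarrow> sat F V ((\<sigma> \<circ> r)(x := a)) w A" for a
    by (rule sat_cong) (use z in \<open>auto simp: C_def\<close>)
  moreover have "rename r (All x A) = All z (rename (r(x := z)) A)"
    by (simp add: Let_def z_def C_def)
  ultimately show ?case by (simp only: sat.simps All.IH)
qed (simp_all add: comp_def)

lemma sat_subst: "sat F V \<sigma> w (subst A y x) \<longleftrightarrow> sat F V (\<sigma>(x := \<sigma> y)) w A"
proof -
  have "\<sigma> \<circ> id(x := y) = \<sigma>(x := \<sigma> y)" by auto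
  then show ?thesis by (simp only: subst_def sat_rename)
qed

text \<open>The two assignments to \<open>A\<close> can differ only at \<open>y\<close>, which
  either is \<open>x\<close> or is not free in \<open>A\<close>. This serves both bound renaming and
  the eigenvariable of \<open>RAll\<close>.\<close>

lemma sat_subst_fresh:
  assumes "y \<notin> fv (All x A)"
  shows "sat F V (\<sigma>(y := a)) w (subst A y x) \<longleftrightarrow> sat F V (\<sigma>(x := a)) w A"
  unfolding sat_subst by (rule sat_cong) (use assms in auto)

lemma sat_alpha: "alpha A B \<Longrightarrow> sat F V \<sigma> w A \<longleftrightarrow> sat F V \<sigma> w B"
proof (induction arbitrary: \<sigma> w rule: alpha.induct)
  case (alpha_rename y x A)
  then have "sat F V (\<sigma>(x := a)) w A \<longleftrightarrow> sat F V (\<sigma>(y := a)) w (subst A y x)" for a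
    by (rule sat_subst_fresh[symmetric])
  then show ?case by simp
qed auto

section \<open>Countermodels of nested sequents\<close>

definition node_refutes ::
  "('w, 'd) frame \<Rightarrow> ('w, 'd) valuation \<Rightarrow> (var \<Rightarrow> 'd) \<Rightarrow> var multiset \<Rightarrow> form multiset \<Rightarrow>
    form multiset \<Rightarrow> 'w \<Rightarrow> bool" where
  "node_refutes F V \<sigma> X \<Gamma> \<Delta> w \<longleftrightarrow>
     (\<forall>x \<in># X. \<sigma> x \<in> dom F w) \<and> (\<forall>A \<in># \<Gamma>. sat F V \<sigma> w A) \<and> (\<forall>A \<in># \<Delta>. \<not> sat F V \<sigma> w A)"

text \<open>Recursion through a multiset of children goes via \<open>image_mset\<close>, hence the
  quantifier over predicates of worlds; \<open>refutes_unfold\<close> gives the readable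
  form.\<close>

primrec refutes ::
  "('w, 'd) frame \<Rightarrow> ('w, 'd) valuation \<Rightarrow> (var \<Rightarrow> 'd) \<Rightarrow> nseq \<Rightarrow> 'w \<Rightarrow> bool" where
  "refutes F V \<sigma> (NS X \<Gamma> \<Delta> Ss) = (\<lambda>w. node_refutes F V \<sigma> X \<Gamma> \<Delta> w \<and>
     (\<forall>f \<in># image_mset (refutes F V \<sigma>) Ss. \<exists>v. (w, v) \<in> acc F \<and> f v))"

lemma refutes_unfold:
  "refutes F V \<sigma> S w \<longleftrightarrow> node_refutes F V \<sigma> (signat S) (ante S) (succd S) w \<and>
    (\<forall>T \<in># children S. \<exists>v. (w, v) \<in> acc F \<and> refutes F V \<sigma> T v)"
  by (cases S) simp

section \<open>Countermodels as failure of the formula interpretation\<close>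

lemma sat_conj_list: "sat F V \<sigma> w (conj_list As) \<longleftrightarrow> (\<forall>A \<in> set As. sat F V \<sigma> w A)"
  by (induction As rule: conj_list.induct) (auto simp: Top_def Neg_def And_def)

lemma sat_disj_list: "sat F V \<sigma> w (disj_list As) \<longleftrightarrow> (\<exists>A \<in> set As. sat F V \<sigma> w A)"
  by (induction As rule: disj_list.induct) (auto simp: Neg_def Or_def)

lemma set_listing: "set (listing M) = set_mset M"
proof -
  have "mset (listing M) = M" unfolding listing_def by (rule someI_ex) (rule ex_mset)
  then show ?thesis by (metis set_mset_mset)
qed

lemma sat_BigAnd: "sat F V \<sigma> w (BigAnd M) \<longleftrightarrow> (\<forall>A \<in># M. sat F V \<sigma> w A)"
  by (simp add: BigAnd_def sat_conj_list set_listing)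

lemma sat_BigOr: "sat F V \<sigma> w (BigOr M) \<longleftrightarrow> (\<exists>A \<in># M. sat F V \<sigma> w A)"
  by (simp add: BigOr_def sat_disj_list set_listing)

text \<open>Since \<open>Suc x\<close> differs from \<open>x\<close>, the only possible witness is
  the object \<sigma> x itself.\<close>

lemma sat_Exists_pred: "sat F V \<sigma> w (Exists_pred x) \<longleftrightarrow> \<sigma> x \<in> dom F w"
  by (auto simp: Exists_pred_def Exi_def Neg_def)

lemma sat_fm: "sat F V \<sigma> w (fm S) \<longleftrightarrow> \<not> refutes F V \<sigma> S w"
proof (induction S arbitrary: w)
  case (NS X \<Gamma> \<Delta> Ss)
  have "(\<exists>T \<in># Ss. sat F V \<sigma> w (Box (fm T))) \<longleftrightarrow>
    \<not> (\<forall>T \<in># Ss. \<exists>v. (w, v) \<in> acc F \<and> refutes F V \<sigma> T v)"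
    using NS by auto
  \<comment> \<open>The clause for \<open>Box\<close> is withheld so that the equivalence above,
    stated with \<open>Box\<close> intact, can rewrite the goal.\<close>
  then show ?case
    by (simp add: Or_def And_def Neg_def sat_BigAnd sat_BigOr sat_Exists_pred node_refutes_def
        del: sat.simps(6))
qed

section \<open>Invariance of countermodels under bound renaming\<close>

lemma rel_mset_ball_iff:
  assumes "rel_mset R M N" and "\<And>a b. R a b \<Longrightarrow> P a \<longleftrightarrow> Q b"
  shows "(\<forall>a \<in># M. P a) \<longleftrightarrow> (\<forall>b \<in># N. Q b)"
proof -
  obtain xs ys where *: "mset xs = M" "mset ys = N" "list_all2 R xs ys"
    using assms(1) by (auto simp: rel_mset_def)
  have "(\<forall>a \<in> set xs. P a) \<longleftrightarrow> (\<forall>b \<in> set ys. Q b)"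
    using *(3) by induction (auto simp: assms(2))
  with * show ?thesis by auto
qed

lemma refutes_alpha_nseq: "alpha_nseq S T \<Longrightarrow> refutes F V \<sigma> S w \<longleftrightarrow> refutes F V \<sigma> T w"
proof (induction arbitrary: w rule: alpha_nseq.induct)
  case (1 \<Gamma> \<Gamma>' \<Delta> \<Delta>' Ss Ss' X)
  have "(\<forall>A \<in># \<Gamma>. sat F V \<sigma> w A) \<longleftrightarrow> (\<forall>A \<in># \<Gamma>'. sat F V \<sigma> w A)"
    using 1(1) by (rule rel_mset_ball_iff) (rule sat_alpha)
  moreover have "(\<forall>A \<in># \<Delta>. \<not> sat F V \<sigma> w A) \<longleftrightarrow> (\<forall>A \<in># \<Delta>'. \<not> sat F V \<sigma> w A)"
    using 1(2) by (rule rel_mset_ball_iff) (simp add: sat_alpha)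
  \<comment> \<open>The relation in \<open>1(3)\<close> also carries the induction hypothesis, at
    every world.\<close>
  moreover have "(\<forall>S \<in># Ss. \<exists>v. (w, v) \<in> acc F \<and> refutes F V \<sigma> S v) \<longleftrightarrow>
      (\<forall>S \<in># Ss'. \<exists>v. (w, v) \<in> acc F \<and> refutes F V \<sigma> S v)"
    using 1(3) by (rule rel_mset_ball_iff) auto
  ultimately show ?case by (simp add: node_refutes_def)
qed

lemma node_refutes_cong:
  assumes "\<And>x. x \<in> set_mset X \<union> \<Union> (fv ` set_mset (\<Gamma> + \<Delta>)) \<Longrightarrow> \<sigma> x = \<tau> x"
  shows "node_refutes F V \<sigma> X \<Gamma> \<Delta> w \<longleftrightarrow> node_refutes F V \<tau> X \<Gamma> \<Delta> w"
proof -
  have "sat F V \<sigma> w A \<longleftrightarrow> sat F V \<tau> w A" if "A \<in># \<Gamma> + \<Delta>" for A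
    by (rule sat_cong) (use assms that in auto)
  then show ?thesis using assms by (auto simp: node_refutes_def)
qed

text \<open>This is the shape \<open>plug\<close> gives to a node: its own content merged with that
  of its holes.\<close>

lemma node_refutes_union:
  "node_refutes F V \<sigma> (X + (\<Sum>i\<in>#H. f i)) (\<Gamma> + (\<Sum>i\<in>#H. g i)) (\<Delta> + (\<Sum>i\<in>#H. k i)) w \<longleftrightarrow>
    node_refutes F V \<sigma> X \<Gamma> \<Delta> w \<and> (\<forall>i \<in># H. node_refutes F V \<sigma> (f i) (g i) (k i) w)"
  by (auto simp: node_refutes_def)

section \<open>Countermodels of contexts\<close>

text \<open>\<open>h i\<close> is the world at which the node of hole \<open>i\<close> is interpreted.\<close>

primrec ctx_refutes ::
  "('w, 'd) frame \<Rightarrow> ('w, 'd) valuation \<Rightarrow> (var \<Rightarrow> 'd) \<Rightarrow> (nat \<Rightarrow> 'w) \<Rightarrow> ctx \<Rightarrow> 'w \<Rightarrow> bool" where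
  "ctx_refutes F V \<sigma> h (Ctx X \<Gamma> \<Delta> H Cs) = (\<lambda>w. node_refutes F V \<sigma> X \<Gamma> \<Delta> w \<and>
     (\<forall>i \<in># H. h i = w) \<and>
     (\<forall>f \<in># image_mset (ctx_refutes F V \<sigma> h) Cs. \<exists>v. (w, v) \<in> acc F \<and> f v))"

lemma ctx_refutes_holes_cong:
  "(\<And>i. i \<in># holes C \<Longrightarrow> h i = k i) \<Longrightarrow> ctx_refutes F V \<sigma> h C w \<longleftrightarrow> ctx_refutes F V \<sigma> k C w"
proof (induction C arbitrary: w)
  case (Ctx X \<Gamma> \<Delta> H Cs)
  have "ctx_refutes F V \<sigma> h C v \<longleftrightarrow> ctx_refutes F V \<sigma> k C v" if "C \<in># Cs" for C v
    by (rule Ctx.IH) (use Ctx.prems that in auto)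
  then show ?case using Ctx.prems by simp
qed

text \<open>Content and node of a hole share the world \<open>h i\<close>, so successors witnessing
  the children of the content also serve at the merged node.\<close>

lemma refutes_plugI:
  "ctx_refutes F V \<sigma> h C w \<Longrightarrow> (\<And>i. i \<in># holes C \<Longrightarrow> refutes F V \<sigma> (Ts ! i) (h i)) \<Longrightarrow>
    refutes F V \<sigma> (plug C Ts) w"
proof (induction C arbitrary: w)
  case (Ctx X \<Gamma> \<Delta> H Cs)
  have root: "refutes F V \<sigma> (Ts ! i) w" if "i \<in># H" for i
    using Ctx.prems(1) Ctx.prems(2)[of i] that by simp
  have node: "node_refutes F V \<sigma> (signat (Ts ! i)) (ante (Ts ! i)) (succd (Ts ! i)) w"
    if "i \<in># H" for i
    using root[OF that] by (simp add: refutes_unfold[of F V \<sigma> "Ts ! i"])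
  have sub: "\<exists>v. (w, v) \<in> acc F \<and> refutes F V \<sigma> T v" if "i \<in># H" "T \<in># children (Ts ! i)" for i T
    using root[OF that(1)] that(2) by (simp add: refutes_unfold[of F V \<sigma> "Ts ! i"])
  have "\<exists>v. (w, v) \<in> acc F \<and> refutes F V \<sigma> (plug C Ts) v" if C: "C \<in># Cs" for C
  proof -
    obtain v where v: "(w, v) \<in> acc F" "ctx_refutes F V \<sigma> h C v"
      using Ctx.prems(1) C by auto
    have "refutes F V \<sigma> (plug C Ts) v"
      by (rule Ctx.IH[OF C v(2)]) (use Ctx.prems(2) C in auto)
    with v(1) show ?thesis by blast
  qed
  then show ?case using Ctx.prems(1) node sub by (auto simp: node_refutes_union)
qed

text \<open>Distinctness of the hole numbers allows the worlds chosen in the subtrees to be combined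
  into a single map.\<close>

lemma refutes_plugE:
  "refutes F V \<sigma> (plug C Ts) w \<Longrightarrow> (\<And>i. count (holes C) i \<le> 1) \<Longrightarrow>
    \<exists>h. ctx_refutes F V \<sigma> h C w \<and> (\<forall>i \<in># holes C. refutes F V \<sigma> (Ts ! i) (h i))"
proof (induction C arbitrary: w)
  case (Ctx X \<Gamma> \<Delta> H Cs)
  have sum_le: "count (holes C) i \<le> count (\<Sum>\<^sub># (image_mset holes Cs)) i" if "C \<in># Cs" for C i
    using that by (auto dest!: multi_member_split)
  have le1: "count H i + count (\<Sum>\<^sub># (image_mset holes Cs)) i \<le> 1" for i
    using Ctx.prems(2)[of i] by simp
  have node: "node_refutes F V \<sigma> X \<Gamma> \<Delta> w"
    using Ctx.prems(1) by (simp add: node_refutes_union)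
  have hole: "refutes F V \<sigma> (Ts ! i) w" if "i \<in># H" for i
  proof (subst refutes_unfold, intro conjI ballI)
    show "node_refutes F V \<sigma> (signat (Ts ! i)) (ante (Ts ! i)) (succd (Ts ! i)) w"
      using Ctx.prems(1) that by (simp add: node_refutes_union)
    fix T assume "T \<in># children (Ts ! i)"
    then have "refutes F V \<sigma> T \<in># image_mset (refutes F V \<sigma>) (\<Sum>i\<in>#H. children (Ts ! i))"
      using that by (auto intro!: imageI)
    then show "\<exists>v. (w, v) \<in> acc F \<and> refutes F V \<sigma> T v"
      using Ctx.prems(1) by auto
  qed
  have "\<exists>v h. (w, v) \<in> acc F \<and> ctx_refutes F V \<sigma> h C v \<and>
      (\<forall>i \<in># holes C. refutes F V \<sigma> (Ts ! i) (h i))" if C: "C \<in># Cs" for C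
  proof -
    obtain v where v: "(w, v) \<in> acc F" "refutes F V \<sigma> (plug C Ts) v"
      using Ctx.prems(1) C by auto
    have "count (holes C) i \<le> 1" for i
      using sum_le[OF C, of i] le1[of i] by linarith
    with Ctx.IH[OF C v(2)] v(1) show ?thesis by blast
  qed
  \<comment> \<open>Worlds and hole maps are chosen as functions of the child; equal copies may
    share a world.\<close>
  then obtain wo hm where sub: "\<And>C. C \<in># Cs \<Longrightarrow> (w, wo C) \<in> acc F"
    "\<And>C. C \<in># Cs \<Longrightarrow> ctx_refutes F V \<sigma> (hm C) C (wo C)"
    "\<And>C i. C \<in># Cs \<Longrightarrow> i \<in># holes C \<Longrightarrow> refutes F V \<sigma> (Ts ! i) (hm C i)"
    by metis
  \<comment> \<open>Holes at this node go to \<open>w\<close>; any other hole uses the map of the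
    child containing it, which \<open>h_sub\<close> shows to be unique.\<close>
  define h where "h i = (if i \<in># H then w else hm (SOME C. C \<in># Cs \<and> i \<in># holes C) i)" for i
  have h_sub: "h i = hm C i" if C: "C \<in># Cs" and i: "i \<in># holes C" for C i
  proof -
    have "i \<notin># H"
      using sum_le[OF C, of i] le1[of i] i by (auto simp flip: count_greater_zero_iff)
    moreover have "C' = C" if C': "C' \<in># Cs \<and> i \<in># holes C'" for C'
    proof (rule ccontr)
      assume "C' \<noteq> C"
      \<comment> \<open>Two different children containing hole \<open>i\<close> would make its total
        count at least 2.\<close>
      then obtain Ds where "Cs = add_mset C (add_mset C' Ds)"
        using C C' by (metis insert_noteq_member mset_add)
      then have "count (holes C) i + count (holes C') i \<le> count (\<Sum>\<^sub># (image_mset holes Cs)) i"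
        by simp
      then show False
        using le1[of i] i C' by (auto simp flip: count_greater_zero_iff)
    qed
    then have "(SOME C. C \<in># Cs \<and> i \<in># holes C) = C"
      using C i by (blast intro: some_equality)
    ultimately show ?thesis by (simp add: h_def)
  qed
  have "ctx_refutes F V \<sigma> h C (wo C)" if "C \<in># Cs" for C
    using sub(2)[OF that] ctx_refutes_holes_cong[of C h "hm C"] h_sub[OF that] by blast
  then have "ctx_refutes F V \<sigma> h (Ctx X \<Gamma> \<Delta> H Cs) w"
    using node sub(1) by (auto simp: h_def)
  moreover have "refutes F V \<sigma> (Ts ! i) (h i)" if i: "i \<in># holes (Ctx X \<Gamma> \<Delta> H Cs)" for i
  proof (cases "i \<in># H")
    case True
    then show ?thesis using hole by (simp add: h_def)
  next
    case False
    then obtain C where "C \<in># Cs" "i \<in># holes C" using i by auto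
    then show ?thesis using h_sub sub(3) by simp
  qed
  ultimately show ?case by blast
qed

text \<open>Reachability from the root keeps the worlds of holes inside \<open>worlds F\<close>,
  where the frame properties apply.\<close>

lemma ctx_refutes_rtrancl:
  "ctx_refutes F V \<sigma> h C w \<Longrightarrow> i \<in># holes C \<Longrightarrow> (w, h i) \<in> (acc F)\<^sup>*"
proof (induction C arbitrary: w)
  case (Ctx X \<Gamma> \<Delta> H Cs)
  show ?case
  proof (cases "i \<in># H")
    case True
    then show ?thesis using Ctx.prems(1) by simp
  next
    case False
    then obtain C where C: "C \<in># Cs" "i \<in># holes C" using Ctx.prems(2) by auto
    then obtain v where "(w, v) \<in> acc F" "ctx_refutes F V \<sigma> h C v" using Ctx.prems(1) by auto
    then show ?thesis using Ctx.IH[OF C(1) _ C(2)] by (meson converse_rtrancl_into_rtrancl)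
  qed
qed

lemma ctx_refutes_relpow:
  "hole_depth C i d \<Longrightarrow> ctx_refutes F V \<sigma> h C w \<Longrightarrow> (w, h i) \<in> acc F ^^ d"
proof (induction arbitrary: w rule: hole_depth.induct)
  case (2 C Cs i d X \<Gamma> \<Delta> H)
  then obtain v where "(w, v) \<in> acc F" "ctx_refutes F V \<sigma> h C v" by auto
  then show ?case using 2(3) by (meson relpow_Suc_I2)
qed simp

text \<open>Here the depth conditions of \<open>R_5\<close> and \<open>R_5dom\<close> take effect: a
  hole below the root is reached in at least one step.\<close>

lemma ctx_refutes_trancl:
  "hole_depth C i d \<Longrightarrow> 1 \<le> d \<Longrightarrow> ctx_refutes F V \<sigma> h C w \<Longrightarrow> (w, h i) \<in> (acc F)\<^sup>+"
  unfolding trancl_power using ctx_refutes_relpow[of C i d F V \<sigma> h w]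
  by (intro exI[of _ d]) simp

section \<open>Free variables and plugging\<close>

lemma nfv_unfold:
  "nfv S = set_mset (signat S) \<union> \<Union> (fv ` set_mset (ante S + succd S)) \<union>
    \<Union> (nfv ` set_mset (children S))"
  by (cases S) (auto simp: nfv_def)

lemmas nfv_NS = nfv_unfold[of "NS X \<Gamma> \<Delta> Ss" for X \<Gamma> \<Delta> Ss, simplified]

text \<open>The context contributes all its free variables to the plugged sequent, whatever
  \<open>Ts\<close> is. So changing the value of a variable fresh for the conclusion of
  \<open>RAll\<close> leaves the context refuted.\<close>

lemma ctx_refutes_cong:
  "(\<And>x. x \<in> nfv (plug C Ts) \<Longrightarrow> \<sigma> x = \<tau> x) \<Longrightarrow>
    ctx_refutes F V \<sigma> h C w \<longleftrightarrow> ctx_refutes F V \<tau> h C w"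
proof (induction C arbitrary: w)
  case (Ctx X \<Gamma> \<Delta> H Cs)
  have "ctx_refutes F V \<sigma> h C v \<longleftrightarrow> ctx_refutes F V \<tau> h C v" if "C \<in># Cs" for C v
    by (rule Ctx.IH[OF that]) (use Ctx.prems that in \<open>auto simp: nfv_NS\<close>)
  moreover have "node_refutes F V \<sigma> X \<Gamma> \<Delta> w \<longleftrightarrow> node_refutes F V \<tau> X \<Gamma> \<Delta> w"
    by (rule node_refutes_cong) (rule Ctx.prems, auto simp: nfv_NS)
  ultimately show ?case by simp
qed

text \<open>Transfers freshness from the whole conclusion of \<open>RAll\<close> to its active
  part.\<close>

lemma nfv_plug: "i \<in># holes C \<Longrightarrow> nfv (Ts ! i) \<subseteq> nfv (plug C Ts)"
proof (induction C)
  case (Ctx X \<Gamma> \<Delta> H Cs)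
  show ?case
  proof (cases "i \<in># H")
    case True
    then show ?thesis by (auto simp: nfv_NS nfv_unfold[of "Ts ! i"])
  next
    case False
    then obtain C where "C \<in># Cs" "i \<in># holes C" using Ctx.prems by auto
    with Ctx.IH[of C] show ?thesis by (auto simp: nfv_NS)
  qed
qed

section \<open>Soundness of the rules\<close>

lemma refutes_plug1E:
  assumes "refutes F V \<sigma> (plug C [T]) w" "n_holes 1 C"
  obtains h where "ctx_refutes F V \<sigma> h C w" "refutes F V \<sigma> T (h 0)" "(w, h 0) \<in> (acc F)\<^sup>*"
proof -
  have H: "holes C = {#0#}" using assms(2) by (simp add: n_holes_def)
  then have le1: "count (holes C) i \<le> 1" for i by simp
  then obtain h where "ctx_refutes F V \<sigma> h C w" "refutes F V \<sigma> T (h 0)"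
    using refutes_plugE[OF assms(1) le1] by (auto simp: H)
  with H ctx_refutes_rtrancl[of F V \<sigma> h C w 0] show thesis using that by simp
qed

lemma refutes_plug1I:
  "ctx_refutes F V \<sigma> h C w \<Longrightarrow> n_holes 1 C \<Longrightarrow> refutes F V \<sigma> T (h 0) \<Longrightarrow> refutes F V \<sigma> (plug C [T]) w"
  by (rule refutes_plugI[of F V \<sigma> h]) (auto simp: n_holes_def)

text \<open>Reduces a one-hole rule that keeps the assignment to a local check at a reachable
  world.\<close>

lemma refutes_plug1_mono:
  assumes "refutes F V \<sigma> (plug C [T]) w" "n_holes 1 C"
    and "\<And>v. (w, v) \<in> (acc F)\<^sup>* \<Longrightarrow> refutes F V \<sigma> T v \<Longrightarrow> refutes F V \<sigma> T' v"
  shows "refutes F V \<sigma> (plug C [T']) w"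
  using assms by (metis refutes_plug1E refutes_plug1I)

text \<open>The map \<open>h\<close> stays exposed with \<open>ctx_refutes\<close>, so that depth
  conditions can be turned into reachability of \<open>h 0\<close> and \<open>h 1\<close>.\<close>

lemma refutes_plug2_mono:
  assumes "refutes F V \<sigma> (plug C [T, U]) w" "n_holes 2 C"
    and "\<And>h. ctx_refutes F V \<sigma> h C w \<Longrightarrow> (w, h 0) \<in> (acc F)\<^sup>* \<Longrightarrow> (w, h 1) \<in> (acc F)\<^sup>* \<Longrightarrow>
      refutes F V \<sigma> T (h 0) \<Longrightarrow> refutes F V \<sigma> U (h 1) \<Longrightarrow>
      refutes F V \<sigma> T' (h 0) \<and> refutes F V \<sigma> U' (h 1)"
  shows "refutes F V \<sigma> (plug C [T', U']) w"
proof -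
  have H: "holes C = {#0, 1#}" using assms(2) by (simp add: n_holes_def upt_rec)
  then have le1: "count (holes C) i \<le> 1" for i by simp
  then obtain h where h: "ctx_refutes F V \<sigma> h C w" "refutes F V \<sigma> T (h 0)" "refutes F V \<sigma> U (h 1)"
    using refutes_plugE[OF assms(1) le1] by (auto simp: H)
  have "refutes F V \<sigma> T' (h 0) \<and> refutes F V \<sigma> U' (h 1)"
    by (rule assms(3)) (use h H ctx_refutes_rtrancl[OF h(1)] in auto)
  then show ?thesis using h(1) H by (intro refutes_plugI[of F V \<sigma> h]) auto
qed

text \<open>Along the path to \<open>u\<close>, each world still sees all immediate successors of
  \<open>w\<close>; then \<open>u\<close> sees every world on the path to \<open>v\<close>.\<close>

lemma euclidean_trancl:
  assumes euc: "\<And>w v u. (w, v) \<in> R \<Longrightarrow> (w, u) \<in> R \<Longrightarrow> (v, u) \<in> R"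
    and "(w, u) \<in> R\<^sup>+" "(w, v) \<in> R\<^sup>+"
  shows "(u, v) \<in> R"
proof -
  have first: "(u, b) \<in> R" if "(w, b) \<in> R" for b
    using assms(2) by induction (use that euc in blast)+
  \<comment> \<open>The last step into \<open>u\<close>, used twice in the Euclidean property, gives
    the loop.\<close>
  have refl: "(u, u) \<in> R" using assms(2) by cases (use euc in blast)+
  show ?thesis using assms(3)
    \<comment> \<open>If \<open>u\<close> sees \<open>y\<close>, the loop at \<open>u\<close> gives
      an edge from \<open>y\<close> back to \<open>u\<close>; hence \<open>u\<close> sees every
      successor of \<open>y\<close>.\<close>
    by induction (use first refl euc in blast)+
qed

text \<open>Valuation and root world stay fixed. For \<open>Init\<close> and \<open>LBot\<close> the
  list of premisses is empty, so the conclusion asserts that no countermodel exists.\<close>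

lemma rule_sound:
  fixes F :: "('w, 'd) frame"
  assumes F: "QL_frame L F" and \<sigma>: "\<forall>x. \<sigma> x \<in> all_objects F" and w: "w \<in> worlds F"
    and "rule L Ps S y" and S: "refutes F V \<sigma> S w"
  shows "\<exists>P \<in> set Ps. \<exists>\<tau>. (\<forall>x. \<tau> x \<in> all_objects F) \<and> refutes F V \<tau> P w"
proof -
  have ax: "frame_prop Z F" if "Z \<in> L" for Z using F that by (simp add: QL_frame_def)
  have sub: "acc F \<subseteq> worlds F \<times> worlds F" using F by (simp add: QL_frame_def is_frame_def)
  have wo: "v \<in> worlds F" if "(w, v) \<in> (acc F)\<^sup>*" for v
    using that w sub by (induction) auto
  have keep: ?thesis if "P \<in> set Ps" "refutes F V \<sigma> P w" for P
    using that \<sigma> by blast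
  have euc: "(v, u) \<in> acc F" if "Ax5 \<in> L" "(w, v) \<in> (acc F)\<^sup>+" "(w, u) \<in> (acc F)\<^sup>+" for v u
  proof (rule euclidean_trancl[OF _ that(2,3)])
    show "(x, z) \<in> acc F" if "(y, x) \<in> acc F" "(y, z) \<in> acc F" for x y z
      using ax[OF \<open>Ax5 \<in> L\<close>] that unfolding frame_prop.simps by blast
  qed
  from \<open>rule L Ps S y\<close> S show ?thesis
  proof (cases rule: rule.cases)
    case (Init C P X \<Gamma> \<Delta>)
    then show ?thesis using S by (auto simp: node_refutes_def elim!: refutes_plug1E)
  next
    case (LBot C X \<Gamma> \<Delta>)
    then show ?thesis using S by (auto simp: node_refutes_def elim!: refutes_plug1E)
  next
    case (LImp C X \<Gamma> A \<Delta> B)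
    obtain h where h: "ctx_refutes F V \<sigma> h C w"
      "refutes F V \<sigma> (NS X (add_mset (Imp A B) \<Gamma>) \<Delta> {#}) (h 0)"
      using S LImp refutes_plug1E by metis
    then have "refutes F V \<sigma> (NS X \<Gamma> (add_mset A \<Delta>) {#}) (h 0) \<or>
        refutes F V \<sigma> (NS X (add_mset B \<Gamma>) \<Delta> {#}) (h 0)"
      by (auto simp: node_refutes_def)
    then show ?thesis
      using refutes_plug1I[OF h(1) LImp(4)] keep LImp(1) by fastforce
  next
    case (RImp C X A \<Gamma> B \<Delta>)
    show ?thesis
      by (rule keep, simp add: RImp(1), rule refutes_plug1_mono[OF S[unfolded RImp(2)] RImp(4)])
        (auto simp: node_refutes_def)
  next
    case (LAll C z X A x \<Gamma> \<Delta>)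
    show ?thesis
      by (rule keep, simp add: LAll(1), rule refutes_plug1_mono[OF S[unfolded LAll(2)] LAll(4)])
        (auto simp: node_refutes_def sat_subst)
  next
    case (RAll C X \<Gamma> x A \<Delta> e)
    let ?T = "NS X \<Gamma> (add_mset (All x A) \<Delta>) {#}"
    obtain h where h: "ctx_refutes F V \<sigma> h C w" "refutes F V \<sigma> ?T (h 0)" "(w, h 0) \<in> (acc F)\<^sup>*"
      using S RAll refutes_plug1E by metis
    then obtain a where a: "a \<in> dom F (h 0)" "\<not> sat F V (\<sigma>(x := a)) (h 0) A"
      by (auto simp: node_refutes_def)
    \<comment> \<open>The eigenvariable names the counterexample \<open>a\<close>; as
      \<open>a\<close> lies in the local domain, the new signature entry holds.\<close>
    define \<tau> where "\<tau> = \<sigma>(e := a)"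
    have agree: "\<sigma> v = \<tau> v" if "v \<in> nfv (plug C [?T])" for v
      using that RAll by (auto simp: \<tau>_def)
    have fresh: "e \<notin> nfv ?T"
      using nfv_plug[of 0 C "[?T]"] RAll by (auto simp: n_holes_def)
    have "node_refutes F V \<tau> X \<Gamma> \<Delta> (h 0)"
    proof (subst node_refutes_cong[of _ _ _ _ \<sigma>])
      show "node_refutes F V \<sigma> X \<Gamma> \<Delta> (h 0)" using h(2) by (auto simp: node_refutes_def)
    qed (use fresh in \<open>auto simp: \<tau>_def nfv_def\<close>)
    moreover have "\<not> sat F V \<tau> (h 0) (subst A e x)"
      unfolding \<tau>_def by (subst sat_subst_fresh) (use fresh a in \<open>auto simp: nfv_def\<close>)
    moreover have "\<tau> e = a" by (simp add: \<tau>_def)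
    ultimately have "refutes F V \<tau> (NS (add_mset e X) \<Gamma> (add_mset (subst A e x) \<Delta>) {#}) (h 0)"
      using a(1) by (auto simp: node_refutes_def)
    moreover have "ctx_refutes F V \<tau> h C w"
      by (rule iffD1[OF ctx_refutes_cong[OF agree] h(1)])
    moreover have "\<forall>x. \<tau> x \<in> all_objects F"
      using \<sigma> a(1) wo[OF h(3)] by (auto simp: \<tau>_def all_objects_def)
    moreover have "n_holes 1 C" using RAll by simp
    ultimately show ?thesis using RAll(1) refutes_plug1I by (metis list.set_intros(1))
  next
    case (LBox C X A \<Gamma> \<Delta> Y \<Pi> \<Sigma> Ss)
    show ?thesis
      by (rule keep, simp add: LBox(1), rule refutes_plug1_mono[OF S[unfolded LBox(2)] LBox(4)])
        (auto simp: node_refutes_def)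
  next
    case (RBox C X \<Gamma> \<Delta> A)
    show ?thesis
      by (rule keep, simp add: RBox(1), rule refutes_plug1_mono[OF S[unfolded RBox(2)] RBox(4)])
        (auto simp: node_refutes_def)
  next
    case (Ref C X x \<Gamma> \<Delta>)
    show ?thesis
      by (rule keep, simp add: Ref(1), rule refutes_plug1_mono[OF S[unfolded Ref(2)] Ref(4)])
        (auto simp: node_refutes_def)
  next
    case (Repl C P X y z x \<Gamma> \<Delta>)
    \<comment> \<open>As \<sigma> x = \<sigma> y, both instances evaluate \<open>P\<close> under the
      same modified assignment.\<close>
    show ?thesis
      by (rule keep, simp add: Repl(1), rule refutes_plug1_mono[OF S[unfolded Repl(2)] Repl(4)])
        (auto simp: node_refutes_def sat_subst)
  next
    case (ReplX C x y X \<Gamma> \<Delta>)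
    show ?thesis
      by (rule keep, simp add: ReplX(1), rule refutes_plug1_mono[OF S[unfolded ReplX(2)] ReplX(4)])
        (auto simp: node_refutes_def)
  next
    case (Rig C X x y \<Gamma> \<Delta> Y \<Pi> \<Sigma>)
    \<comment> \<open>The truth of an equality depends on the assignment alone, not on the
      world.\<close>
    show ?thesis
      by (rule keep, simp add: Rig(1), rule refutes_plug2_mono[OF S[unfolded Rig(2)] Rig(4)])
        (auto simp: node_refutes_def)
  next
    case (R_D C X \<Gamma> \<Delta>)
    show ?thesis
      by (rule keep, simp add: R_D(1), rule refutes_plug1_mono[OF S[unfolded R_D(2)] R_D(5)])
        (use ax[OF R_D(4)] wo in \<open>auto simp: node_refutes_def\<close>)
  next
    case (R_T C X A \<Gamma> \<Delta>)
    show ?thesis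
      by (rule keep, simp add: R_T(1), rule refutes_plug1_mono[OF S[unfolded R_T(2)] R_T(5)])
        (use ax[OF R_T(4)] wo in \<open>auto simp: node_refutes_def\<close>)
  next
    case (R_B C X A \<Gamma> \<Delta> Y \<Pi> \<Sigma> Ss)
    show ?thesis
      by (rule keep, simp add: R_B(1), rule refutes_plug1_mono[OF S[unfolded R_B(2)] R_B(5)])
        (use ax[OF R_B(4)] in \<open>auto simp: node_refutes_def dest: symD\<close>)
  next
    case (R_4 C X A \<Gamma> \<Delta> Y \<Pi> \<Sigma> Ss)
    then have "trans (acc F)" using ax[of Ax4] by simp
    then show ?thesis
      by (intro keep, simp add: R_4(1), intro refutes_plug1_mono[OF S[unfolded R_4(2)] R_4(5)])
        (auto simp: node_refutes_def dest: transD)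
  next
    case (R_5 C d X A \<Gamma> \<Delta> Y \<Pi> \<Sigma>)
    show ?thesis
    proof (rule keep, simp add: R_5(1), rule refutes_plug2_mono[OF S[unfolded R_5(2)] R_5(5)])
      fix h
      assume h: "ctx_refutes F V \<sigma> h C w" "(w, h 1) \<in> (acc F)\<^sup>*"
        and T: "refutes F V \<sigma> (NS X (add_mset (Box A) \<Gamma>) \<Delta> {#}) (h 0)"
          "refutes F V \<sigma> (NS Y \<Pi> \<Sigma> {#}) (h 1)"
      \<comment> \<open>Any \<open>v\<close> seen from \<open>h 1\<close> is at least one step from
        the root, even if \<open>h 1\<close> is the root; so is \<open>h 0\<close>, by its
        depth.\<close>
      have "(h 0, v) \<in> acc F" if "(h 1, v) \<in> acc F" for v
        using euc[OF R_5(4) ctx_refutes_trancl[OF R_5(6,7) h(1)]] rtrancl_into_trancl1[OF h(2) that]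
        by blast
      then have "sat F V \<sigma> (h 1) (Box A)" using T(1) by (auto simp: node_refutes_def)
      with T show "refutes F V \<sigma> (NS X (add_mset (Box A) \<Gamma>) \<Delta> {#}) (h 0) \<and>
          refutes F V \<sigma> (NS Y (add_mset (Box A) \<Pi>) \<Sigma> {#}) (h 1)"
        by (auto simp: node_refutes_def)
    qed
  next
    case (R_cbf C x X \<Gamma> \<Delta> Y \<Pi> \<Sigma> Ss)
    show ?thesis
      by (rule keep, simp add: R_cbf(1), rule refutes_plug1_mono[OF S[unfolded R_cbf(2)] R_cbf(5)])
        (use ax[OF R_cbf(4)] in \<open>fastforce simp: node_refutes_def\<close>)
  next
    case (R_bf C x X \<Gamma> \<Delta> Y \<Pi> \<Sigma> Ss)
    show ?thesis
      by (rule keep, simp add: R_bf(1), rule refutes_plug1_mono[OF S[unfolded R_bf(2)] R_bf(5)])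
        (use ax[OF R_bf(4)] in \<open>auto simp: node_refutes_def\<close>)
  next
    case (R_ui C x X \<Gamma> \<Delta>)
    \<comment> \<open>Every value of an assignment exists at some world, and \<open>AxUI\<close>
      carries it to all worlds.\<close>
    obtain u where "u \<in> worlds F" "\<sigma> x \<in> dom F u" using \<sigma> by (auto simp: all_objects_def)
    then have "\<sigma> x \<in> dom F v" if "(w, v) \<in> (acc F)\<^sup>*" for v
      using wo[OF that] ax[OF R_ui(4)] unfolding frame_prop.simps by blast
    then show ?thesis
      by (intro keep, simp add: R_ui(1), intro refutes_plug1_mono[OF S[unfolded R_ui(2)] R_ui(5)])
        (auto simp: node_refutes_def)
  next
    case (R_5dom C d d' x X \<Gamma> \<Delta> Y \<Pi> \<Sigma>)
    show ?thesis
    proof (rule keep, simp add: R_5dom(1), rule refutes_plug2_mono[OF S[unfolded R_5dom(2)] R_5dom(6)])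
      fix h
      assume h: "ctx_refutes F V \<sigma> h C w"
        and T: "refutes F V \<sigma> (NS (add_mset x X) \<Gamma> \<Delta> {#}) (h 0)"
          "refutes F V \<sigma> (NS Y \<Pi> \<Sigma> {#}) (h 1)"
      have "(h 0, h 1) \<in> acc F" "(h 1, h 0) \<in> acc F"
        using euc[OF R_5dom(4)] ctx_refutes_trancl[OF R_5dom(7,8) h]
          ctx_refutes_trancl[OF R_5dom(9,10) h] by auto
      \<comment> \<open>\<open>AxCBF\<close> uses the edge from \<open>h 0\<close> to
        \<open>h 1\<close>, \<open>AxBF\<close> the reverse edge; either one gives this
        inclusion.\<close>
      then have "dom F (h 0) \<subseteq> dom F (h 1)"
        using R_5dom(5) ax[of AxCBF] ax[of AxBF] by auto
      with T show "refutes F V \<sigma> (NS (add_mset x X) \<Gamma> \<Delta> {#}) (h 0) \<and>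
          refutes F V \<sigma> (NS (add_mset x Y) \<Pi> \<Sigma> {#}) (h 1)"
        by (auto simp: node_refutes_def)
    qed
  qed
qed

text \<open>The assignment is generalised in the induction because a premiss of \<open>RAll\<close>
  may be refuted only under a changed one.\<close>

lemma derivation_sound:
  fixes F :: "('w, 'd) frame"
  assumes "QL_frame L F" and "w \<in> worlds F"
  shows "is_derivation L d \<Longrightarrow> \<forall>x. \<sigma> x \<in> all_objects F \<Longrightarrow> \<not> refutes F V \<sigma> (endseq d) w"
proof (induction d arbitrary: \<sigma>)
  case (Infer S y ds)
  show ?case
  proof
    assume "refutes F V \<sigma> (endseq (Infer S y ds)) w"
    moreover have "rule L (map endseq ds) S y" using Infer.prems(1) by simp
    ultimately obtain d \<tau> where "d \<in> set ds" "\<forall>x. \<tau> x \<in> all_objects F" "refutes F V \<tau> (endseq d) w"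
      using rule_sound[OF assms(1) Infer.prems(2) assms(2)] by fastforce
    then show False using Infer.IH Infer.prems(1) by (auto simp: list_all_iff)
  qed
qed

theorem theorem3:
  fixes I :: "nat \<Rightarrow> nat set" and L :: "axiom set" and S :: nseq
  assumes "properly_closed L"
    and "nseq_in_language I S"
    and "derivable L S"
  shows "QL_valid TYPE('w) TYPE('d) L (fm S)"
proof -
  obtain d where d: "alpha_nseq S (endseq d)" "is_derivation L d"
    using assms(3) by (auto simp: derivable_def has_derivation_def)
  show ?thesis
    \<comment> \<open>Truth of \<open>fm S\<close> becomes non-refutation of \<open>S\<close>, then
      of the alphabetical variant actually derived.\<close>
    unfolding QL_valid_def valid_in_def sat_fm refutes_alpha_nseq[OF d(1)]
    by (intro allI impI) (rule derivation_sound[OF _ _ d(2)])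
qed

end
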